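(* For every connected graph $G$, there is a homeomorphism $\mathrm{Ult}(\mathfrak C(G))\approx\mathcal D_E(G)$ between the ultrafilter space of the cut algebra of $G$ and the edge-direction space of $G$.
   Context: Graphs are simple and undirected, possibly infinite. Cut algebra. For $A\subset V(G)$ let $E(A,G\setminus A)$ be the set of edges with one end in $A$ and the other in $V(G)\setminus A$. Let $\mathfrak c(G)=\{A\subset V(G) : E(A,G\setminus A)\text{ is finite}\}$, a Boolean subalgebra of $2^{V(G)}$, and let $I_G$ be the ideal of finite sets of vertices all of which have finite degree. The (finite) cut algebra is $\mathfrak C(G)=\mathfrak c(G)/I_G$ (elements $A,B$ are identified when $A\,\Delta\,B\in I_G$). Ultrafilter space. For a Boolean algebra $\mathfrak B$ (the one-element algebra is allowed), a filter is a nonempty upward closed subset closed under $\wedge$ and not containing $0$; an ultrafilter is a maximal filter. $\mathrm{Ult}(\mathfrak B)$ is the set of ultrafilters with basic open sets $[B]=\{u : B\in u\}$, $B\in\mathfrak B$ (empty if $0=1$). Edge-direction space. For finite $F\subset E(G)$, let $\mathcal S^E_F$ be the set of infinite connected components of $G\setminus F$ (edges of $F$ deleted). $\mathcal D_E(G)$ is the set of functions $\rho$ assigning to each finite $F\subset E(G)$ an element $\rho(F)\in\mathcal S^E_F$ such that $\rho(F')\subset\rho(F)$ whenever $F\subset F'$, with the topology whose basic open sets are $\{\rho' : \rho'(F)=\rho(F)\}$ for $\rho\in\mathcal D_E(G)$ and $F\subset E(G)$ finite (i.e. the inverse limit topology with discrete $\mathcal S^E_F$). *)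

theory Defs
  imports "HOL-Analysis.Analysis"
begin

section \<open>Graphs\<close>

definition simple_graph :: "'a set \<Rightarrow> 'a set set \<Rightarrow> bool" where
  "simple_graph V E \<longleftrightarrow> (\<forall>e\<in>E. e \<subseteq> V \<and> card e = 2)"

definition reachable :: "'a set set \<Rightarrow> 'a \<Rightarrow> 'a \<Rightarrow> bool" where
  "reachable E = (\<lambda>u v. {u, v} \<in> E)\<^sup>*\<^sup>*"

text \<open>A connected component is represented by its vertex set.  Nothing is lost: if \<open>F \<subseteq> F'\<close>, a
  component of \<open>G - F'\<close> is a subgraph of a component of \<open>G - F\<close> iff this holds for
  the vertex sets.\<close>

definition components :: "'a set \<Rightarrow> 'a set set \<Rightarrow> 'a set set" where
  "components V E = {{v \<in> V. reachable E u v} |u. u \<in> V}"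

definition connected_graph :: "'a set \<Rightarrow> 'a set set \<Rightarrow> bool" where
  "connected_graph V E \<longleftrightarrow> (\<forall>u\<in>V. \<forall>v\<in>V. reachable E u v)"


section \<open>Boolean algebras and their ultrafilter spaces\<close>

record 'b bool_alg =
  elems :: "'b set"
  meet :: "'b \<Rightarrow> 'b \<Rightarrow> 'b"
  join :: "'b \<Rightarrow> 'b \<Rightarrow> 'b"
  compl :: "'b \<Rightarrow> 'b"
  zero :: 'b
  one :: 'b

text \<open>The laws are those of the library locale \<open>abstract_boolean_algebra\<close>, relativised to the
  carrier.  As there, \<open>zero B = one B\<close> is allowed.\<close>

locale bool_algebra =
  fixes B :: "('b, 'm) bool_alg_scheme"
  assumes meet_closed: "\<lbrakk>x \<in> elems B; y \<in> elems B\<rbrakk> \<Longrightarrow> meet B x y \<in> elems B"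
    and join_closed: "\<lbrakk>x \<in> elems B; y \<in> elems B\<rbrakk> \<Longrightarrow> join B x y \<in> elems B"
    and compl_closed: "x \<in> elems B \<Longrightarrow> compl B x \<in> elems B"
    and zero_closed: "zero B \<in> elems B"
    and one_closed: "one B \<in> elems B"
    and meet_assoc: "\<lbrakk>x \<in> elems B; y \<in> elems B; z \<in> elems B\<rbrakk> \<Longrightarrow>
          meet B (meet B x y) z = meet B x (meet B y z)"
    and meet_commute: "\<lbrakk>x \<in> elems B; y \<in> elems B\<rbrakk> \<Longrightarrow> meet B x y = meet B y x"
    and join_assoc: "\<lbrakk>x \<in> elems B; y \<in> elems B; z \<in> elems B\<rbrakk> \<Longrightarrow>
          join B (join B x y) z = join B x (join B y z)"
    and join_commute: "\<lbrakk>x \<in> elems B; y \<in> elems B\<rbrakk> \<Longrightarrow> join B x y = join B y x"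
    and meet_join_distrib: "\<lbrakk>x \<in> elems B; y \<in> elems B; z \<in> elems B\<rbrakk> \<Longrightarrow>
          meet B x (join B y z) = join B (meet B x y) (meet B x z)"
    and join_meet_distrib: "\<lbrakk>x \<in> elems B; y \<in> elems B; z \<in> elems B\<rbrakk> \<Longrightarrow>
          join B x (meet B y z) = meet B (join B x y) (join B x z)"
    and meet_one: "x \<in> elems B \<Longrightarrow> meet B x (one B) = x"
    and join_zero: "x \<in> elems B \<Longrightarrow> join B x (zero B) = x"
    and meet_compl: "x \<in> elems B \<Longrightarrow> meet B x (compl B x) = zero B"
    and join_compl: "x \<in> elems B \<Longrightarrow> join B x (compl B x) = one B"

definition ba_le :: "('b, 'm) bool_alg_scheme \<Rightarrow> 'b \<Rightarrow> 'b \<Rightarrow> bool" where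
  "ba_le B x y \<longleftrightarrow> meet B x y = x"

definition ba_filter :: "('b, 'm) bool_alg_scheme \<Rightarrow> 'b set \<Rightarrow> bool" where
  "ba_filter B u \<longleftrightarrow>
     u \<subseteq> elems B \<and> u \<noteq> {} \<and>
     (\<forall>x\<in>u. \<forall>y\<in>elems B. ba_le B x y \<longrightarrow> y \<in> u) \<and>
     (\<forall>x\<in>u. \<forall>y\<in>u. meet B x y \<in> u) \<and>
     zero B \<notin> u"

definition Ult :: "('b, 'm) bool_alg_scheme \<Rightarrow> 'b set set" where
  "Ult B = {u. ba_filter B u \<and> (\<forall>w. ba_filter B w \<and> u \<subseteq> w \<longrightarrow> w = u)}"

definition ult_basic :: "('b, 'm) bool_alg_scheme \<Rightarrow> 'b \<Rightarrow> 'b set set" where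
  "ult_basic B b = {u \<in> Ult B. b \<in> u}"

definition ult_space :: "('b, 'm) bool_alg_scheme \<Rightarrow> 'b set topology" where
  "ult_space B = topology_generated_by (ult_basic B ` elems B)"

lemma topspace_ult_space: "topspace (ult_space B) = Ult B"
  by (fastforce simp: ult_space_def ult_basic_def Ult_def ba_filter_def)

lemma (in bool_algebra) meet_absorb:
  assumes "x \<in> elems B" "y \<in> elems B"
  shows "meet B (meet B x y) y = meet B x y" "meet B (meet B x y) x = meet B x y"
proof -
  have idem: "meet B z z = z" if z: "z \<in> elems B" for z
  proof -
    have "meet B z z = join B (meet B z z) (meet B z (compl B z))"
      by (simp add: z meet_compl meet_closed join_zero)
    also have "\<dots> = meet B z (join B z (compl B z))"
      by (simp add: z compl_closed meet_join_distrib)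
    also have "\<dots> = z"
      by (simp add: z join_compl meet_one)
    finally show ?thesis .
  qed
  show "meet B (meet B x y) y = meet B x y"
    by (simp add: assms idem meet_assoc)
  have "meet B (meet B x y) x = meet B x (meet B x y)"
    by (simp add: assms meet_closed meet_commute)
  also have "\<dots> = meet B x y"
    by (simp add: assms idem flip: meet_assoc)
  finally show "meet B (meet B x y) x = meet B x y" .
qed

lemma (in bool_algebra) ult_basic_Int:
  assumes "x \<in> elems B" "y \<in> elems B"
  shows "ult_basic B x \<inter> ult_basic B y = ult_basic B (meet B x y)"
  using assms meet_absorb[OF assms]
  unfolding ult_basic_def Ult_def ba_filter_def ba_le_def by blast

text \<open>The generating sets of \<open>ult_space\<close> form a base, not merely a subbase.\<close>

lemma (in bool_algebra) openin_ult_space: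
  "openin (ult_space B) = arbitrary union_of (\<lambda>U. U \<in> ult_basic B ` elems B)"
proof -
  let ?P = "\<lambda>U. U \<in> ult_basic B ` elems B"
  have top: "istopology (arbitrary union_of ?P)"
    by (rule istopology_base) (auto simp: ult_basic_Int meet_closed)
  have "generate_topology_on (ult_basic B ` elems B) U \<longleftrightarrow> (arbitrary union_of ?P) U" for U
  proof
    show "(arbitrary union_of ?P) U" if "generate_topology_on (ult_basic B ` elems B) U"
      using that
    proof induction
      case Empty
      then show ?case by (simp add: arbitrary_union_of_empty)
    next
      case (Int a b)
      then show ?case using top by (simp add: istopology_def)
    next
      case (UN K)
      then show ?case using top by (simp add: istopology_def)
    next
      case (Basis s)
      then show ?case by (simp add: arbitrary_union_of_inc)
    qed
    show "generate_topology_on (ult_basic B ` elems B) U" if "(arbitrary union_of ?P) U"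
    proof -
      from that obtain K where K: "K \<subseteq> ult_basic B ` elems B" "U = \<Union>K"
        by (auto simp: union_of_def)
      show ?thesis
        unfolding K(2) using K(1) by (intro generate_topology_on.UN generate_topology_on.Basis) blast
    qed
  qed
  then show ?thesis
    by (simp add: fun_eq_iff ult_space_def openin_topology_generated_by_iff)
qed


section \<open>The cut algebra\<close>

definition cut_edges :: "'a set \<Rightarrow> 'a set set \<Rightarrow> 'a set \<Rightarrow> 'a set set" where
  "cut_edges V E A = {e \<in> E. \<exists>u\<in>A. \<exists>v\<in>V - A. e = {u, v}}"

definition cuts :: "'a set \<Rightarrow> 'a set set \<Rightarrow> 'a set set" where
  "cuts V E = {A. A \<subseteq> V \<and> finite (cut_edges V E A)}"

definition cut_ideal :: "'a set \<Rightarrow> 'a set set \<Rightarrow> 'a set set" where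
  "cut_ideal V E = {A. A \<subseteq> V \<and> finite A \<and> (\<forall>v\<in>A. finite {e \<in> E. v \<in> e})}"

definition cut_rel :: "'a set \<Rightarrow> 'a set set \<Rightarrow> ('a set \<times> 'a set) set" where
  "cut_rel V E = {(A, B). A \<in> cuts V E \<and> B \<in> cuts V E \<and> sym_diff A B \<in> cut_ideal V E}"

definition cut_class :: "'a set \<Rightarrow> 'a set set \<Rightarrow> 'a set \<Rightarrow> 'a set set" where
  "cut_class V E A = cut_rel V E `` {A}"

text \<open>The operations on classes are written as unions over all representatives; the lemmas
  \<open>meet_cut_class\<close>, \<open>join_cut_class\<close> and \<open>compl_cut_class\<close> below show that each such union
  is the single class of the operation applied to arbitrary representatives.\<close>

definition cut_algebra :: "'a set \<Rightarrow> 'a set set \<Rightarrow> 'a set set bool_alg" where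
  "cut_algebra V E =
    \<lparr>elems = cuts V E // cut_rel V E,
     meet = (\<lambda>X Y. \<Union>A\<in>X. \<Union>B\<in>Y. cut_class V E (A \<inter> B)),
     join = (\<lambda>X Y. \<Union>A\<in>X. \<Union>B\<in>Y. cut_class V E (A \<union> B)),
     compl = (\<lambda>X. \<Union>A\<in>X. cut_class V E (V - A)),
     zero = cut_class V E {},
     one = cut_class V E V\<rparr>"

lemma cut_ideal_Un: "\<lbrakk>A \<in> cut_ideal V E; B \<in> cut_ideal V E\<rbrakk> \<Longrightarrow> A \<union> B \<in> cut_ideal V E"
  and cut_ideal_subset: "\<lbrakk>A \<in> cut_ideal V E; B \<subseteq> A\<rbrakk> \<Longrightarrow> B \<in> cut_ideal V E"
  by (auto simp: cut_ideal_def intro: finite_subset)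

lemma cut_edges_compl: "A \<subseteq> V \<Longrightarrow> cut_edges V E (V - A) = cut_edges V E A"
  unfolding cut_edges_def by (auto simp: insert_commute double_diff)

lemma cuts_compl: "A \<in> cuts V E \<Longrightarrow> V - A \<in> cuts V E"
  by (auto simp: cuts_def cut_edges_compl)

lemma cuts_Int: assumes "A \<in> cuts V E" "B \<in> cuts V E" shows "A \<inter> B \<in> cuts V E"
proof -
  have "cut_edges V E (A \<inter> B) \<subseteq> cut_edges V E A \<union> cut_edges V E B"
    unfolding cut_edges_def by blast
  then show ?thesis
    using assms by (auto simp: cuts_def intro: finite_subset)
qed

lemma cuts_Un: assumes "A \<in> cuts V E" "B \<in> cuts V E" shows "A \<union> B \<in> cuts V E"
proof -
  have "cut_edges V E (A \<union> B) \<subseteq> cut_edges V E A \<union> cut_edges V E B"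
    unfolding cut_edges_def by blast
  then show ?thesis
    using assms by (auto simp: cuts_def intro: finite_subset)
qed

lemma cuts_empty: "{} \<in> cuts V E"
  by (simp add: cuts_def cut_edges_def)

lemma cuts_full: "V \<in> cuts V E"
  by (simp add: cuts_def cut_edges_def)

lemma cut_ideal_subset_cuts: "cut_ideal V E \<subseteq> cuts V E"
proof
  fix A assume A: "A \<in> cut_ideal V E"
  have "cut_edges V E A \<subseteq> (\<Union>v\<in>A. {e \<in> E. v \<in> e})"
    by (auto simp: cut_edges_def)
  then show "A \<in> cuts V E"
    using A by (auto simp: cuts_def cut_ideal_def intro: finite_subset)
qed

lemma equiv_cut_rel: "equiv (cuts V E) (cut_rel V E)"
proof (rule equivI)
  show "cut_rel V E \<subseteq> cuts V E \<times> cuts V E"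
    by (auto simp: cut_rel_def)
  show "refl_on (cuts V E) (cut_rel V E)"
    by (auto simp: refl_on_def cut_rel_def cut_ideal_def)
  show "sym (cut_rel V E)"
    by (auto simp: sym_def cut_rel_def Un_commute)
  show "trans (cut_rel V E)"
  proof (rule transI)
    fix A B C assume "(A, B) \<in> cut_rel V E" "(B, C) \<in> cut_rel V E"
    then show "(A, C) \<in> cut_rel V E"
      using cut_ideal_subset[OF cut_ideal_Un, of "sym_diff A B" V E "sym_diff B C" "sym_diff A C"]
      by (auto simp: cut_rel_def)
  qed
qed

lemma meet_cut_class:
  assumes "A \<in> cuts V E" "B \<in> cuts V E"
  shows "meet (cut_algebra V E) (cut_class V E A) (cut_class V E B) = cut_class V E (A \<inter> B)"
proof -
  have "(A1 \<inter> B1, A2 \<inter> B2) \<in> cut_rel V E"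
    if "(A1, A2) \<in> cut_rel V E" "(B1, B2) \<in> cut_rel V E" for A1 A2 B1 B2
    using that cuts_Int[of A1 V E B1] cuts_Int[of A2 V E B2]
      cut_ideal_subset[OF cut_ideal_Un, of "sym_diff A1 A2" V E "sym_diff B1 B2"
        "sym_diff (A1 \<inter> B1) (A2 \<inter> B2)"]
    by (auto simp: cut_rel_def)
  then have "(\<lambda>A B. cut_class V E (A \<inter> B)) respects2 cut_rel V E"
    unfolding cut_class_def
    by (intro congruent2I' equiv_class_eq[OF equiv_cut_rel])
  from UN_equiv_class2[OF equiv_cut_rel equiv_cut_rel this assms] show ?thesis
    by (simp add: cut_algebra_def cut_class_def)
qed

lemma join_cut_class:
  assumes "A \<in> cuts V E" "B \<in> cuts V E"
  shows "join (cut_algebra V E) (cut_class V E A) (cut_class V E B) = cut_class V E (A \<union> B)"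
proof -
  have "(A1 \<union> B1, A2 \<union> B2) \<in> cut_rel V E"
    if "(A1, A2) \<in> cut_rel V E" "(B1, B2) \<in> cut_rel V E" for A1 A2 B1 B2
    using that cuts_Un[of A1 V E B1] cuts_Un[of A2 V E B2]
      cut_ideal_subset[OF cut_ideal_Un, of "sym_diff A1 A2" V E "sym_diff B1 B2"
        "sym_diff (A1 \<union> B1) (A2 \<union> B2)"]
    by (auto simp: cut_rel_def)
  then have "(\<lambda>A B. cut_class V E (A \<union> B)) respects2 cut_rel V E"
    unfolding cut_class_def
    by (intro congruent2I' equiv_class_eq[OF equiv_cut_rel])
  from UN_equiv_class2[OF equiv_cut_rel equiv_cut_rel this assms] show ?thesis
    by (simp add: cut_algebra_def cut_class_def)
qed

lemma compl_cut_class: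
  assumes "A \<in> cuts V E"
  shows "compl (cut_algebra V E) (cut_class V E A) = cut_class V E (V - A)"
proof -
  have "(V - A1, V - A2) \<in> cut_rel V E" if "(A1, A2) \<in> cut_rel V E" for A1 A2
    using that cuts_compl[of A1 V E] cuts_compl[of A2 V E]
      cut_ideal_subset[of "sym_diff A1 A2" V E "sym_diff (V - A1) (V - A2)"]
    by (auto simp: cut_rel_def)
  then have "(\<lambda>A. cut_class V E (V - A)) respects cut_rel V E"
    unfolding cut_class_def
    by (intro congruentI equiv_class_eq[OF equiv_cut_rel])
  from UN_equiv_class[OF equiv_cut_rel this assms] show ?thesis
    by (simp add: cut_algebra_def cut_class_def)
qed

lemma elems_cut_algebra: "elems (cut_algebra V E) = cut_class V E ` cuts V E"
  by (auto simp: cut_algebra_def cut_class_def quotient_def)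

lemma zero_cut_algebra: "zero (cut_algebra V E) = cut_class V E {}"
  and one_cut_algebra: "one (cut_algebra V E) = cut_class V E V"
  by (simp_all add: cut_algebra_def)

lemma bool_algebra_cut_algebra: "bool_algebra (cut_algebra V E)"
proof -
  have V: "A \<inter> V = A" if "A \<in> cuts V E" for A
    using that by (auto simp: cuts_def)
  have V': "A \<union> V = V" if "A \<in> cuts V E" for A
    using that by (auto simp: cuts_def)
  note ops = elems_cut_algebra zero_cut_algebra one_cut_algebra meet_cut_class join_cut_class
    compl_cut_class cuts_Int cuts_Un cuts_compl cuts_empty cuts_full
  show ?thesis
    by unfold_locales
      (clarsimp simp: ops V V', (rule arg_cong[where f = "cut_class V E"], blast)?)+
qed


section \<open>The edge-direction space\<close>

definition inf_components :: "'a set \<Rightarrow> 'a set set \<Rightarrow> 'a set set \<Rightarrow> 'a set set" where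
  "inf_components V E F = {C \<in> components V (E - F). infinite C}"

definition fin_edge_sets :: "'a set set \<Rightarrow> 'a set set set" where
  "fin_edge_sets E = {F. F \<subseteq> E \<and> finite F}"

definition edge_directions :: "'a set \<Rightarrow> 'a set set \<Rightarrow> ('a set set \<Rightarrow> 'a set) set" where
  "edge_directions V E =
     {\<rho> \<in> \<Pi>\<^sub>E F\<in>fin_edge_sets E. inf_components V E F.
        \<forall>F\<in>fin_edge_sets E. \<forall>F'\<in>fin_edge_sets E. F \<subseteq> F' \<longrightarrow> \<rho> F' \<subseteq> \<rho> F}"

definition edge_direction_basics ::
    "'a set \<Rightarrow> 'a set set \<Rightarrow> ('a set set \<Rightarrow> 'a set) set set" where
  "edge_direction_basics V E =
     {{\<rho>' \<in> edge_directions V E. \<rho>' F = \<rho> F} |\<rho> F. \<rho> \<in> edge_directions V E \<and> F \<in> fin_edge_sets E}"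

definition edge_direction_space ::
    "'a set \<Rightarrow> 'a set set \<Rightarrow> ('a set set \<Rightarrow> 'a set) topology" where
  "edge_direction_space V E = topology_generated_by (edge_direction_basics V E)"

lemma topspace_edge_direction_space:
  "topspace (edge_direction_space V E) = edge_directions V E"
proof -
  have "{} \<in> fin_edge_sets E" by (simp add: fin_edge_sets_def)
  then show ?thesis
    unfolding edge_direction_space_def edge_direction_basics_def topology_generated_by_topspace
    by blast
qed

text \<open>The topology is the inverse limit topology.\<close>

lemma edge_direction_space_eq_subtopology:
  "edge_direction_space V E =
    subtopology (product_topology (\<lambda>F. discrete_topology (inf_components V E F)) (fin_edge_sets E))
      (edge_directions V E)"
proof (rule topology_eq[THEN iffD2], intro allI iffI)
  let ?P = "product_topology (\<lambda>F. discrete_topology (inf_components V E F)) (fin_edge_sets E)"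
  let ?D = "edge_directions V E"
  let ?T = "edge_direction_space V E"
  have top_sub: "topspace (subtopology ?P ?D) = ?D"
    by (auto simp: edge_directions_def)
  have open_basic: "openin ?T {\<rho>' \<in> ?D. \<rho>' F = \<rho> F}" if "\<rho> \<in> ?D" "F \<in> fin_edge_sets E" for \<rho> F
    using that unfolding edge_direction_space_def edge_direction_basics_def
    by (intro topology_generated_by_Basis) blast
  fix U
  show "openin (subtopology ?P ?D) U" if "openin ?T U"
  proof -
    have basic: "openin (subtopology ?P ?D) {\<rho>' \<in> ?D. \<rho>' F = \<rho> F}"
      if "\<rho> \<in> ?D" "F \<in> fin_edge_sets E" for \<rho> F
    proof -
      have "openin ?P {f \<in> topspace ?P. f F \<in> {\<rho> F}}"
      proof (rule openin_continuous_map_preimage)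
        show "continuous_map ?P (discrete_topology (inf_components V E F)) (\<lambda>f. f F)"
          by (rule continuous_map_product_projection[OF that(2)])
        show "openin (discrete_topology (inf_components V E F)) {\<rho> F}"
          using that by (auto simp: edge_directions_def)
      qed
      moreover have "{\<rho>' \<in> ?D. \<rho>' F = \<rho> F} = {f \<in> topspace ?P. f F \<in> {\<rho> F}} \<inter> ?D"
        by (auto simp: edge_directions_def)
      ultimately show ?thesis
        by (auto simp: openin_subtopology)
    qed
    have "generate_topology_on (edge_direction_basics V E) U"
      using that by (simp add: edge_direction_space_def openin_topology_generated_by_iff)
    then show ?thesis
    proof induction
      case (Basis s)
      then show ?case using basic by (auto simp: edge_direction_basics_def)
    qed auto
  qed
  show "openin ?T U" if "openin (subtopology ?P ?D) U"
  proof -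
    have "continuous_map ?T ?P (\<lambda>\<rho>. \<rho>)"
      unfolding continuous_map_componentwise topspace_edge_direction_space
    proof (intro conjI ballI)
      show "(\<lambda>\<rho>. \<rho>) ` ?D \<subseteq> extensional (fin_edge_sets E)"
        by (auto simp: edge_directions_def PiE_def)
      fix F assume F: "F \<in> fin_edge_sets E"
      have "openin ?T {\<rho> \<in> ?D. \<rho> F \<in> W}" for W
      proof -
        have "{\<rho> \<in> ?D. \<rho> F \<in> W} = (\<Union>\<rho> \<in> {\<rho> \<in> ?D. \<rho> F \<in> W}. {\<rho>' \<in> ?D. \<rho>' F = \<rho> F})"
          by auto
        also have "openin ?T \<dots>"
          using open_basic F by (intro openin_Union) auto
        finally show ?thesis .
      qed
      then show "continuous_map ?T (discrete_topology (inf_components V E F)) (\<lambda>\<rho>. \<rho> F)"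
        using F by (auto simp: continuous_map_def topspace_edge_direction_space edge_directions_def)
    qed
    then have "continuous_map ?T (subtopology ?P ?D) (\<lambda>\<rho>. \<rho>)"
      by (simp add: continuous_map_in_subtopology topspace_edge_direction_space)
    from openin_continuous_map_preimage[OF this that]
    have "openin ?T {\<rho> \<in> ?D. \<rho> \<in> U}"
      by (simp add: topspace_edge_direction_space)
    moreover have "U \<subseteq> ?D"
      using openin_subset[OF that] top_sub by auto
    ultimately show ?thesis
      by (simp add: Int_absorb1 Collect_conj_eq)
  qed
qed

end

theory Submission
  imports Defs
begin

text \<open>Deleting a finite edge set \<open>F\<close> from a connected graph leaves only finitely many components,
  each of which has its boundary inside \<open>F\<close>; a finite one has only vertices of finite degree and so
  is zero in the cut algebra.  Hence an ultrafilter of the cut algebra contains the class of exactly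
  one component of \<open>G - F\<close>, an infinite one, and this choice is an edge-direction.  Conversely,
  a direction \<open>\<rho>\<close> gives the ultrafilter of all cuts \<open>A\<close> with \<open>\<rho> (\<delta> A) \<subseteq> A\<close>, where
  \<open>\<delta> A\<close> is the finite set of edges between \<open>A\<close> and its complement.\<close>

section \<open>Ultrafilters\<close>

text \<open>If every element of \<open>u\<close> met \<open>b\<close> in a nonzero element,
  \<open>u\<close> and \<open>b\<close> would generate a proper filter, against maximality. So some
  \<open>x\<close> in \<open>u\<close> is disjoint from \<open>b\<close> and hence lies below the
  complement of \<open>b\<close>.\<close>

lemma (in bool_algebra) Ult_compl_mem:
  assumes u: "u \<in> Ult B" and b: "b \<in> elems B" "b \<notin> u"
  shows "compl B b \<in> u"
proof -
  have filt: "ba_filter B u" and max: "\<And>w. ba_filter B w \<Longrightarrow> u \<subseteq> w \<Longrightarrow> w = u"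
    using u by (auto simp: Ult_def)
  have sub: "u \<subseteq> elems B" and ne: "u \<noteq> {}"
    and up: "\<And>x y. x \<in> u \<Longrightarrow> y \<in> elems B \<Longrightarrow> meet B x y = x \<Longrightarrow> y \<in> u"
    and int: "\<And>x y. x \<in> u \<Longrightarrow> y \<in> u \<Longrightarrow> meet B x y \<in> u"
    using filt by (auto simp: ba_filter_def ba_le_def)
  have "\<exists>x\<in>u. meet B x b = zero B"
  proof (rule ccontr)
    assume contra: "\<not> (\<exists>x\<in>u. meet B x b = zero B)"
    \<comment> \<open>The filter generated by \<open>u\<close> and \<open>b\<close>: everything
      above some \<open>meet B x b\<close> with \<open>x\<close> in \<open>u\<close>.\<close>
    define w where "w = {y \<in> elems B. \<exists>x\<in>u. meet B (meet B x b) y = meet B x b}"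
    have trans: "meet B a z = a" if "meet B a y = a" "meet B y z = y"
      "a \<in> elems B" "y \<in> elems B" "z \<in> elems B" for a y z
      using that by (metis meet_assoc)
    have uw: "u \<subseteq> w"
      using sub b(1) by (auto simp: w_def intro!: bexI meet_absorb)
    have bw: "b \<in> w"
      using sub b(1) ne by (auto simp: w_def intro!: meet_absorb)
    have "ba_filter B w"
      unfolding ba_filter_def ba_le_def
    proof (intro conjI ballI impI)
      show "w \<subseteq> elems B" by (auto simp: w_def)
      show "w \<noteq> {}" using bw by auto
      fix x y assume x: "x \<in> w"
      show "y \<in> w" if "y \<in> elems B" "meet B x y = x"
      proof -
        obtain a where a: "a \<in> u" "meet B (meet B a b) x = meet B a b" and "x \<in> elems B"
          using x by (auto simp: w_def)
        with that trans[of "meet B a b" x y] show ?thesis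
          using sub b(1) meet_closed by (auto simp: w_def)
      qed
      show "meet B x y \<in> w" if y: "y \<in> w"
      proof -
        obtain a where a: "a \<in> u" "meet B (meet B a b) x = meet B a b" and xe: "x \<in> elems B"
          using x by (auto simp: w_def)
        obtain c where c: "c \<in> u" "meet B (meet B c b) y = meet B c b" and ye: "y \<in> elems B"
          using y by (auto simp: w_def)
        have ac: "a \<in> elems B" "c \<in> elems B" using a c sub by auto
        let ?m = "meet B (meet B a c) b"
        \<comment> \<open>In this form \<open>?m\<close> visibly lies below both witnesses, hence
          below \<open>x\<close> and \<open>y\<close>.\<close>
        have m: "?m = meet B (meet B a b) (meet B c b)"
        proof -
          have "meet B (meet B a b) (meet B c b) = meet B a (meet B b (meet B c b))"
            using ac b(1) by (simp add: meet_assoc meet_closed)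
          also have "meet B b (meet B c b) = meet B c b"
            using ac b(1) meet_absorb(1)[of c b] by (simp add: meet_commute meet_closed)
          finally show ?thesis using ac b(1) by (simp add: meet_assoc)
        qed
        have ab: "meet B a b \<in> elems B" "meet B c b \<in> elems B" "?m \<in> elems B"
          using ac b(1) by (simp_all add: meet_closed)
        have "meet B ?m x = ?m"
          using trans[of ?m "meet B a b" x] meet_absorb(2)[of "meet B a b" "meet B c b"] ab a xe m
          by simp
        moreover have "meet B ?m y = ?m"
          using trans[of ?m "meet B c b" y] meet_absorb(1)[of "meet B a b" "meet B c b"] ab c ye m
          by simp
        ultimately have "meet B ?m (meet B x y) = ?m"
          using ab xe ye by (metis meet_assoc)
        then show ?thesis
          using int[OF a(1) c(1)] xe ye by (auto simp: w_def meet_closed)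
      qed
    next
      show "zero B \<notin> w"
      proof
        assume "zero B \<in> w"
        then obtain x where x: "x \<in> u" "meet B (meet B x b) (zero B) = meet B x b"
          by (auto simp: w_def)
        have e: "meet B x b \<in> elems B" using x sub b(1) meet_closed by auto
        \<comment> \<open>Zero is the meet of \<open>meet B x b\<close> with its complement, so
          absorption applies.\<close>
        have "meet B (meet B x b) (zero B) = zero B"
          using meet_absorb(2)[of "meet B x b" "compl B (meet B x b)"] e
          by (simp add: meet_compl compl_closed meet_commute zero_closed)
        then show False using x contra by auto
      qed
    qed
    then show False using max[OF _ uw] bw b(2) by auto
  qed
  then obtain x where x: "x \<in> u" "meet B x b = zero B" by auto
  have xe: "x \<in> elems B" using x sub by auto
  have "x = meet B x (join B b (compl B b))"
    using b(1) xe by (simp add: join_compl meet_one)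
  also have "\<dots> = join B (meet B x (compl B b)) (zero B)"
    using b(1) xe x
    by (simp add: meet_join_distrib compl_closed join_commute zero_closed meet_closed)
  also have "\<dots> = meet B x (compl B b)"
    using b(1) xe by (simp add: join_zero compl_closed meet_closed)
  finally show ?thesis
    using up[OF x(1)] b(1) compl_closed by metis
qed

lemma cut_class_eq_iff:
  assumes "A \<in> cuts V E" "B \<in> cuts V E"
  shows "cut_class V E A = cut_class V E B \<longleftrightarrow> sym_diff A B \<in> cut_ideal V E"
  using eq_equiv_class_iff[OF equiv_cut_rel assms] assms
  by (simp add: cut_class_def cut_rel_def)

section \<open>Ultrafilters of the cut algebra in terms of representing cuts\<close>

context
  fixes V :: "'a set" and E u
  assumes u: "u \<in> Ult (cut_algebra V E)"
begin

lemma Ult_cut_filter: "ba_filter (cut_algebra V E) u"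
  using u by (simp add: Ult_def)

lemma Ult_cut_empty: "cut_class V E {} \<notin> u"
  using Ult_cut_filter by (simp add: ba_filter_def zero_cut_algebra)

lemma Ult_cut_Int:
  assumes "A \<in> cuts V E" "B \<in> cuts V E" "cut_class V E A \<in> u" "cut_class V E B \<in> u"
  shows "cut_class V E (A \<inter> B) \<in> u"
  using Ult_cut_filter assms by (metis ba_filter_def meet_cut_class)

lemma Ult_cut_mono:
  assumes "A \<in> cuts V E" "B \<in> cuts V E" "cut_class V E A \<in> u" "A \<subseteq> B"
  shows "cut_class V E B \<in> u"
proof -
  have "ba_le (cut_algebra V E) (cut_class V E A) (cut_class V E B)"
    using assms by (simp add: ba_le_def meet_cut_class Int_absorb2)
  then show ?thesis
    using Ult_cut_filter assms by (auto simp: ba_filter_def elems_cut_algebra)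
qed

lemma Ult_cut_meets:
  assumes "A \<in> cuts V E" "B \<in> cuts V E" "cut_class V E A \<in> u" "cut_class V E B \<in> u"
  shows "A \<inter> B \<noteq> {}"
  using Ult_cut_Int[OF assms] Ult_cut_empty by metis

lemma Ult_cut_ideal:
  assumes "A \<in> cut_ideal V E"
  shows "cut_class V E A \<notin> u"
proof -
  have "cut_class V E A = cut_class V E {}"
    using assms cut_ideal_subset_cuts cuts_empty by (subst cut_class_eq_iff) auto
  then show ?thesis using Ult_cut_empty by simp
qed

lemma Ult_cut_compl:
  assumes "A \<in> cuts V E" "cut_class V E A \<notin> u"
  shows "cut_class V E (V - A) \<in> u"
  using bool_algebra.Ult_compl_mem[OF bool_algebra_cut_algebra u, of "cut_class V E A"] assms
  by (simp add: compl_cut_class elems_cut_algebra)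

text \<open>Otherwise \<open>u\<close> contains the complement of every member, hence the class of
  the intersection of these complements, which is empty. Applied below to the components of G -
  F.\<close>

lemma Ult_cut_finite_cover:
  assumes "finite \<C>" "\<C> \<subseteq> cuts V E" "\<Union>\<C> = V"
  obtains C where "C \<in> \<C>" "cut_class V E C \<in> u"
proof (rule ccontr)
  assume "\<not> thesis"
  then have none: "\<And>C. C \<in> \<C> \<Longrightarrow> cut_class V E C \<notin> u" using that by auto
  have "V - \<Union>\<C> \<in> cuts V E \<and> cut_class V E (V - \<Union>\<C>) \<in> u"
    using assms(1,2) none
  proof (induction \<C>)
    case empty
    show ?case
      using Ult_cut_compl[OF cuts_empty Ult_cut_empty] by (simp add: cuts_full)
  next
    case (insert C \<C>)
    have "V - \<Union>(insert C \<C>) = (V - C) \<inter> (V - \<Union>\<C>)" by auto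
    then show ?case
      using insert Ult_cut_compl[of C] by (simp add: Ult_cut_Int cuts_Int cuts_compl)
  qed
  then show False using assms(3) Ult_cut_empty by simp
qed

end

section \<open>Components after deleting finitely many edges\<close>

lemma reachable_sym: "reachable E a b \<Longrightarrow> reachable E b a"
  unfolding reachable_def
  by (rule sympD[OF symp_rtranclp]) (auto simp: symp_def insert_commute)

lemma reachable_trans: "reachable E a b \<Longrightarrow> reachable E b c \<Longrightarrow> reachable E a c"
  unfolding reachable_def by (rule rtranclp_trans)

lemma reachable_mono: "reachable E a b \<Longrightarrow> E \<subseteq> E' \<Longrightarrow> reachable E' a b"
  unfolding reachable_def by (erule rtranclp_mono[THEN predicate2D, rotated]) auto

text \<open>A path that leaves \<open>A\<close> must use an edge of the cut, and all of these are
  deleted.\<close>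

lemma reachable_cut:
  assumes "simple_graph V E" "cut_edges V E A \<subseteq> F" "a \<in> A" "reachable (E - F) a b"
  shows "b \<in> A"
  using assms(4,3) unfolding reachable_def
proof (induction rule: rtranclp_induct)
  case (step y z)
  then have e: "{y, z} \<in> E" "{y, z} \<notin> F" "y \<in> A" by auto
  then have "z \<in> V" using assms(1) by (auto simp: simple_graph_def)
  then show ?case using e assms(2) by (auto simp: cut_edges_def)
qed

lemma Union_components: "\<Union>(components V E) = V"
  by (auto simp: components_def reachable_def)

text \<open>Any vertex of a component may serve as its root.\<close>

lemma components_eq:
  assumes "C \<in> components V E" "a \<in> C"
  shows "C = {v \<in> V. reachable E a v}"
  using assms unfolding components_def by (auto intro: reachable_trans reachable_sym)

lemma components_Int: "\<lbrakk>C \<in> components V E; D \<in> components V E; C \<inter> D \<noteq> {}\<rbrakk> \<Longrightarrow> C = D"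
  using components_eq[of C V E] components_eq[of D V E] by blast

lemma components_nonempty: "C \<in> components V E \<Longrightarrow> C \<noteq> {}"
  by (auto simp: components_def reachable_def)

lemma components_mono:
  assumes "C \<in> components V E" "D \<in> components V E'" "E \<subseteq> E'" "C \<inter> D \<noteq> {}"
  shows "C \<subseteq> D"
proof -
  obtain a where a: "a \<in> C" "a \<in> D" using assms(4) by auto
  show ?thesis
    unfolding components_eq[OF assms(1) a(1)] components_eq[OF assms(2) a(2)]
    using reachable_mono[OF _ assms(3)] by blast
qed

lemma cut_edges_component:
  assumes "C \<in> components V (E - F)"
  shows "cut_edges V E C \<subseteq> F"
proof (rule subsetI, rule ccontr)
  fix e assume "e \<in> cut_edges V E C" "e \<notin> F"
  then obtain a b where ab: "a \<in> C" "b \<in> V - C" "{a, b} \<in> E - F"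
    by (auto simp: cut_edges_def)
  then have "reachable (E - F) a b" by (auto simp: reachable_def)
  then show False using components_eq[OF assms ab(1)] ab by auto
qed

lemma component_cuts:
  assumes "C \<in> components V (E - F)" "finite F"
  shows "C \<in> cuts V E"
  using assms cut_edges_component[OF assms(1)]
  by (auto simp: cuts_def components_def intro: finite_subset)

text \<open>This dichotomy lets the component that a direction chooses decide between
  \<open>A\<close> and its complement.\<close>

lemma component_cut_cases:
  assumes "simple_graph V E" "C \<in> components V (E - F)" "cut_edges V E A \<subseteq> F"
  shows "C \<subseteq> A \<or> C \<inter> A = {}"
proof (rule disjCI)
  assume "C \<inter> A \<noteq> {}"
  then obtain a where a: "a \<in> C" "a \<in> A" by auto
  show "C \<subseteq> A"
    unfolding components_eq[OF assms(2) a(1)] using reachable_cut[OF assms(1,3) a(2)] by blast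
qed

text \<open>An edge at a vertex of \<open>C\<close> either has its other end in the finite set
  \<open>C\<close> or crosses the boundary and so belongs to \<open>F\<close>.\<close>

lemma finite_component_ideal:
  assumes "simple_graph V E" "C \<in> components V (E - F)" "finite F" "finite C"
  shows "C \<in> cut_ideal V E"
proof -
  have "finite {e \<in> E. v \<in> e}" if "v \<in> C" for v
  proof (rule finite_subset)
    show "{e \<in> E. v \<in> e} \<subseteq> F \<union> (\<lambda>x. {v, x}) ` C"
    proof clarify
      fix e assume e: "e \<in> E" "v \<in> e" "e \<notin> (\<lambda>x. {v, x}) ` C"
      then have "e \<subseteq> V" "card e = 2" using assms(1) by (auto simp: simple_graph_def)
      then obtain x where x: "e = {v, x}" "x \<in> V"
        using e(2) by (auto simp: card_2_iff insert_commute)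
      then have "e \<in> cut_edges V E C" using e that by (auto simp: cut_edges_def)
      then show "e \<in> F" using cut_edges_component[OF assms(2)] by auto
    qed
  qed (use assms in auto)
  moreover have "C \<subseteq> V" using assms(2) by (auto simp: components_def)
  ultimately show ?thesis using assms(4) by (simp add: cut_ideal_def)
qed

text \<open>By connectedness, every component other than \<open>V\<close> contains an end of an edge of \<open>F\<close>.\<close>

lemma finite_components:
  assumes "simple_graph V E" "connected_graph V E" "finite F" "F \<subseteq> E"
  shows "finite (components V (E - F))"
proof (rule finite_subset)
  show "components V (E - F) \<subseteq> insert V ((\<lambda>a. {v \<in> V. reachable (E - F) a v}) ` \<Union>F)"
  proof
    fix C assume C: "C \<in> components V (E - F)"
    \<comment> \<open>\<open>reachable_cut\<close> with nothing deleted: all that is reachable from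
      \<open>a\<close>, which is all of \<open>V\<close>, stays in \<open>C\<close>.\<close>
    have "C = V" if "cut_edges V E C = {}"
    proof -
      obtain a where "a \<in> C" using components_nonempty[OF C] by auto
      moreover have "C \<subseteq> V" using C by (auto simp: components_def)
      ultimately show ?thesis
        using assms(2) reachable_cut[OF assms(1), of C "{}" a] that
        by (auto simp: connected_graph_def)
    qed
    moreover have "\<exists>a\<in>\<Union>F. a \<in> C" if "cut_edges V E C \<noteq> {}"
      using that cut_edges_component[OF C] unfolding cut_edges_def by blast
    ultimately show "C \<in> insert V ((\<lambda>a. {v \<in> V. reachable (E - F) a v}) ` \<Union>F)"
      using components_eq[OF C] by blast
  qed
  have "finite e" if "e \<in> F" for e
    using that assms(1,4) by (auto simp: simple_graph_def intro!: card_ge_0_finite)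
  then show "finite (insert V ((\<lambda>a. {v \<in> V. reachable (E - F) a v}) ` \<Union>F))"
    using assms(3) by auto
qed

section \<open>Ultrafilters and edge-directions\<close>

lemma cut_edges_fin: "A \<in> cuts V E \<Longrightarrow> cut_edges V E A \<in> fin_edge_sets E"
  by (auto simp: cuts_def fin_edge_sets_def cut_edges_def)

context
  fixes V :: "'a set" and E :: "'a set set"
  assumes simple: "simple_graph V E"
begin

text \<open>The condition is required of some representative of the class only;
  \<open>cut_class_dir_ult_iff\<close> shows that every representative gives the same
  answer.\<close>

definition dir_ult :: "('a set set \<Rightarrow> 'a set) \<Rightarrow> 'a set set set" where
  "dir_ult \<rho> = cut_class V E ` {A \<in> cuts V E. \<rho> (cut_edges V E A) \<subseteq> A}"

text \<open>The description is justified by \<open>ult_dir_unique\<close> and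
  \<open>ult_dir_component\<close>. Restricting to \<open>fin_edge_sets E\<close> makes the function
  extensional, as \<open>edge_directions\<close> demands.\<close>

definition ult_dir :: "'a set set set \<Rightarrow> 'a set set \<Rightarrow> 'a set" where
  "ult_dir u = (\<lambda>F\<in>fin_edge_sets E. THE C. C \<in> components V (E - F) \<and> cut_class V E C \<in> u)"

section \<open>From directions to ultrafilters\<close>

context
  fixes \<rho>
  assumes \<rho>: "\<rho> \<in> edge_directions V E"
begin

lemma dir_component:
  assumes "F \<in> fin_edge_sets E"
  shows "\<rho> F \<in> components V (E - F)" "infinite (\<rho> F)"
  using \<rho> assms by (auto simp: edge_directions_def inf_components_def)

lemma dir_antimono:
  "F \<in> fin_edge_sets E \<Longrightarrow> F' \<in> fin_edge_sets E \<Longrightarrow> F \<subseteq> F' \<Longrightarrow> \<rho> F' \<subseteq> \<rho> F"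
  using \<rho> by (auto simp: edge_directions_def)

text \<open>Deleting more than \<delta> A does not change the side of \<open>A\<close> chosen by
  \<rho>: the smaller component is nonempty and contained in the larger one, which lies on one side.
  Several cuts can thus be compared at a common \<open>F\<close>.\<close>

lemma dir_subset_iff:
  assumes "A \<in> cuts V E" "F \<in> fin_edge_sets E" "cut_edges V E A \<subseteq> F"
  shows "\<rho> F \<subseteq> A \<longleftrightarrow> \<rho> (cut_edges V E A) \<subseteq> A"
proof -
  note fin = cut_edges_fin[OF assms(1)]
  have sub: "\<rho> F \<subseteq> \<rho> (cut_edges V E A)"
    by (rule dir_antimono[OF fin assms(2,3)])
  then show ?thesis
    using component_cut_cases[OF simple dir_component(1)[OF fin], of A]
      components_nonempty[OF dir_component(1)[OF assms(2)]] by blast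
qed

lemma fin_edge_sets_cut_Un:
  "A \<in> cuts V E \<Longrightarrow> B \<in> cuts V E \<Longrightarrow> cut_edges V E A \<union> cut_edges V E B \<in> fin_edge_sets E"
  using cut_edges_fin[of A V E] cut_edges_fin[of B V E] by (simp add: fin_edge_sets_def)

text \<open>Representatives of one class differ in finitely many vertices, too few to contain an
  infinite component.\<close>

lemma cut_class_dir_ult_iff:
  assumes "A \<in> cuts V E"
  shows "cut_class V E A \<in> dir_ult \<rho> \<longleftrightarrow> \<rho> (cut_edges V E A) \<subseteq> A"
proof
  assume "cut_class V E A \<in> dir_ult \<rho>"
  then obtain B where B: "B \<in> cuts V E" "\<rho> (cut_edges V E B) \<subseteq> B"
    and eq: "cut_class V E A = cut_class V E B" by (auto simp: dir_ult_def)
  define F where "F = cut_edges V E A \<union> cut_edges V E B"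
  have F: "F \<in> fin_edge_sets E"
    unfolding F_def by (rule fin_edge_sets_cut_Un[OF assms B(1)])
  have "\<rho> F \<subseteq> B" using dir_subset_iff[OF B(1) F] B(2) by (simp add: F_def)
  moreover have "finite (sym_diff A B)"
    using eq cut_class_eq_iff[OF assms B(1)] by (auto simp: cut_ideal_def)
  \<comment> \<open>Otherwise the infinite set \<open>\<rho> F\<close> would lie in
    \<open>B - A\<close>.\<close>
  ultimately have "\<rho> F \<inter> A \<noteq> {}"
    using dir_component(2)[OF F] finite_subset[of "\<rho> F" "sym_diff A B"] by blast
  then have "\<rho> F \<subseteq> A"
    using component_cut_cases[OF simple dir_component(1)[OF F], of A] by (auto simp: F_def)
  then show "\<rho> (cut_edges V E A) \<subseteq> A"
    using dir_subset_iff[OF assms F] by (simp add: F_def)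
qed (use assms in \<open>auto simp: dir_ult_def\<close>)

text \<open>At a common \<open>F\<close> all three memberships become inclusions of the same
  \<open>\<rho> F\<close>. The two implications give closure under meets and upward closure.\<close>

lemma dir_ult_Int:
  assumes "A \<in> cuts V E" "B \<in> cuts V E"
  shows "cut_class V E (A \<inter> B) \<in> dir_ult \<rho> \<longleftrightarrow>
    cut_class V E A \<in> dir_ult \<rho> \<and> cut_class V E B \<in> dir_ult \<rho>"
proof -
  define F where "F = cut_edges V E A \<union> cut_edges V E B"
  have F: "F \<in> fin_edge_sets E"
    unfolding F_def by (rule fin_edge_sets_cut_Un[OF assms])
  have "cut_edges V E (A \<inter> B) \<subseteq> F"
    unfolding F_def cut_edges_def by blast
  from dir_subset_iff[OF cuts_Int[OF assms] F this]
    dir_subset_iff[OF assms(1) F] dir_subset_iff[OF assms(2) F] show ?thesis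
    using assms by (auto simp: cut_class_dir_ult_iff cuts_Int F_def)
qed

text \<open>\<open>A\<close> and \<open>V - A\<close> have the same boundary, so one component
  decides both.\<close>

lemma dir_ult_compl:
  assumes "A \<in> cuts V E" "cut_class V E A \<notin> dir_ult \<rho>"
  shows "cut_class V E (V - A) \<in> dir_ult \<rho>"
proof -
  note dir = dir_component(1)[OF cut_edges_fin[OF assms(1)]]
  have AV: "A \<subseteq> V" using assms(1) by (simp add: cuts_def)
  have "\<rho> (cut_edges V E A) \<inter> A = {}"
    using component_cut_cases[OF simple dir] assms by (auto simp: cut_class_dir_ult_iff)
  moreover have "\<rho> (cut_edges V E A) \<subseteq> V"
    using dir by (auto simp: components_def)
  ultimately show ?thesis
    using assms(1) AV by (auto simp: cut_class_dir_ult_iff cuts_compl cut_edges_compl)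
qed

text \<open>Maximality comes from \<open>dir_ult_compl\<close>: a larger filter would contain a
  class together with its complement, hence zero.\<close>

lemma dir_ult_in_Ult: "dir_ult \<rho> \<in> Ult (cut_algebra V E)"
proof -
  have sub: "dir_ult \<rho> \<subseteq> elems (cut_algebra V E)"
    by (auto simp: dir_ult_def elems_cut_algebra)
  have zero: "cut_class V E {} \<notin> dir_ult \<rho>"
    using components_nonempty[OF dir_component(1)[OF cut_edges_fin[OF cuts_empty]]]
    by (simp add: cut_class_dir_ult_iff cuts_empty)
  have "dir_ult \<rho> \<noteq> {}"
    using dir_ult_compl[OF cuts_empty zero] by auto
  then have filt: "ba_filter (cut_algebra V E) (dir_ult \<rho>)"
    unfolding ba_filter_def ba_le_def zero_cut_algebra
  proof (intro conjI ballI impI sub zero)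
    fix x y assume x: "x \<in> dir_ult \<rho>"
    then obtain A where A: "A \<in> cuts V E" "x = cut_class V E A" by (auto simp: dir_ult_def)
    show "y \<in> dir_ult \<rho>" if y: "y \<in> elems (cut_algebra V E)" "meet (cut_algebra V E) x y = x"
    proof -
      obtain B where B: "B \<in> cuts V E" "y = cut_class V E B"
        using y(1) by (auto simp: elems_cut_algebra)
      then show ?thesis
        using y(2) x A dir_ult_Int[OF A(1) B(1)] by (simp add: meet_cut_class)
    qed
    show "meet (cut_algebra V E) x y \<in> dir_ult \<rho>" if y: "y \<in> dir_ult \<rho>"
    proof -
      obtain B where B: "B \<in> cuts V E" "y = cut_class V E B"
        using y by (auto simp: dir_ult_def)
      then show ?thesis
        using x y A dir_ult_Int[OF A(1) B(1)] by (simp add: meet_cut_class)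
    qed
  qed
  have "w \<subseteq> dir_ult \<rho>" if w: "ba_filter (cut_algebra V E) w" "dir_ult \<rho> \<subseteq> w" for w
  proof (rule subsetI, rule ccontr)
    fix x assume x: "x \<in> w" "x \<notin> dir_ult \<rho>"
    then obtain A where A: "A \<in> cuts V E" "x = cut_class V E A"
      using w(1) by (auto simp: ba_filter_def elems_cut_algebra)
    then have "cut_class V E (V - A) \<in> w" using dir_ult_compl x w(2) by blast
    then have "meet (cut_algebra V E) x (cut_class V E (V - A)) \<in> w"
      using w(1) x by (auto simp: ba_filter_def)
    then have "cut_class V E {} \<in> w" using A by (simp add: meet_cut_class cuts_compl)
    then show False using w(1) by (simp add: ba_filter_def zero_cut_algebra)
  qed
  with filt show ?thesis by (auto simp: Ult_def)
qed

end

section \<open>From ultrafilters to directions, and the two round trips\<close>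

context
  fixes u
  assumes connected: "connected_graph V E" and u: "u \<in> Ult (cut_algebra V E)"
begin

text \<open>Distinct components are disjoint, whereas cuts whose classes lie in \<open>u\<close>
  intersect.\<close>

lemma ult_dir_unique:
  assumes "F \<in> fin_edge_sets E" "C \<in> components V (E - F)" "cut_class V E C \<in> u"
  shows "ult_dir u F = C"
proof -
  have fin: "finite F" using assms(1) by (simp add: fin_edge_sets_def)
  have "D = C" if "D \<in> components V (E - F)" "cut_class V E D \<in> u" for D
    using components_Int[OF that(1) assms(2)]
      Ult_cut_meets[OF u component_cuts[OF that(1) fin] component_cuts[OF assms(2) fin] that(2) assms(3)]
    by blast
  then have "(THE D. D \<in> components V (E - F) \<and> cut_class V E D \<in> u) = C"
    using assms(2,3) by (intro the_equality) blast+
  then show ?thesis using assms(1) by (simp add: ult_dir_def)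
qed

text \<open>The components of G - F are finitely many cuts covering \<open>V\<close>, so one of them
  has its class in \<open>u\<close>.\<close>

lemma ult_dir_component:
  assumes "F \<in> fin_edge_sets E"
  shows "ult_dir u F \<in> components V (E - F)" "cut_class V E (ult_dir u F) \<in> u"
proof -
  have fin: "finite F" "F \<subseteq> E" using assms by (auto simp: fin_edge_sets_def)
  obtain C where "C \<in> components V (E - F)" "cut_class V E C \<in> u"
    using Ult_cut_finite_cover[OF u finite_components[OF simple connected fin] _ Union_components]
      component_cuts[OF _ fin(1)] by blast
  with ult_dir_unique[OF assms this]
  show "ult_dir u F \<in> components V (E - F)" "cut_class V E (ult_dir u F) \<in> u" by simp_all
qed

lemma ult_dir_cuts: "F \<in> fin_edge_sets E \<Longrightarrow> ult_dir u F \<in> cuts V E"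
  using component_cuts[OF ult_dir_component(1)] by (simp add: fin_edge_sets_def)

text \<open>Finite components represent zero, so the chosen one is infinite. The choices at
  \<open>F\<close> and \<open>F'\<close> intersect because both classes lie in \<open>u\<close>, so
  they are nested.\<close>

lemma ult_dir_in_edge_directions: "ult_dir u \<in> edge_directions V E"
proof -
  have inf: "infinite (ult_dir u F)" if F: "F \<in> fin_edge_sets E" for F
    using finite_component_ideal[OF simple ult_dir_component(1)[OF F]] Ult_cut_ideal[OF u]
      ult_dir_component(2)[OF F] F by (auto simp: fin_edge_sets_def)
  have "ult_dir u F' \<subseteq> ult_dir u F"
    if "F \<in> fin_edge_sets E" "F' \<in> fin_edge_sets E" "F \<subseteq> F'" for F F'
    using components_mono[OF ult_dir_component(1)[OF that(2)] ult_dir_component(1)[OF that(1)]] that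
      Ult_cut_meets[OF u ult_dir_cuts ult_dir_cuts ult_dir_component(2) ult_dir_component(2), of F' F]
    by blast
  moreover have "ult_dir u \<in> extensional (fin_edge_sets E)"
    unfolding ult_dir_def by simp
  ultimately show ?thesis
    using inf ult_dir_component(1) by (auto simp: edge_directions_def inf_components_def PiE_def)
qed

text \<open>One inclusion suffices, since \<open>dir_ult (ult_dir u)\<close> is itself a maximal
  filter. It holds because a cut that contains a chosen component lies above an element of
  \<open>u\<close>.\<close>

lemma dir_ult_ult_dir: "dir_ult (ult_dir u) = u"
proof -
  have "dir_ult (ult_dir u) \<subseteq> u"
    unfolding dir_ult_def
    using Ult_cut_mono[OF u ult_dir_cuts _ ult_dir_component(2)] cut_edges_fin by blast
  then show ?thesis
    using dir_ult_in_Ult[OF ult_dir_in_edge_directions] u by (auto simp: Ult_def)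
qed

lemma ult_dir_eq_iff:
  assumes "F \<in> fin_edge_sets E" "C \<in> components V (E - F)"
  shows "ult_dir u F = C \<longleftrightarrow> cut_class V E C \<in> u"
  using ult_dir_unique[OF assms] ult_dir_component(2)[OF assms(1)] by auto

end

text \<open>The boundary of \<open>\<rho> F\<close> lies in \<open>F\<close>, so
  \<open>dir_subset_iff\<close> for the cut \<open>\<rho> F\<close> puts its class into
  \<open>dir_ult \<rho>\<close>; uniqueness does the rest.\<close>

lemma ult_dir_dir_ult:
  assumes "connected_graph V E" and \<rho>: "\<rho> \<in> edge_directions V E"
  shows "ult_dir (dir_ult \<rho>) = \<rho>"
proof
  fix F
  show "ult_dir (dir_ult \<rho>) F = \<rho> F"
  proof (cases "F \<in> fin_edge_sets E")
    case True
    note comp = dir_component(1)[OF \<rho> True]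
    have C: "\<rho> F \<in> cuts V E"
      using component_cuts[OF comp] True by (simp add: fin_edge_sets_def)
    have "cut_class V E (\<rho> F) \<in> dir_ult \<rho>"
      using dir_subset_iff[OF \<rho> C True cut_edges_component[OF comp]]
      by (simp add: cut_class_dir_ult_iff[OF \<rho> C])
    then show ?thesis
      by (rule ult_dir_unique[OF assms(1) dir_ult_in_Ult[OF \<rho>] True comp])
  next
    \<comment> \<open>Outside the index set both functions take the value
      \<open>undefined\<close>.\<close>
    case False
    then show ?thesis
      using \<rho> by (auto simp: ult_dir_def edge_directions_def PiE_def extensional_def)
  qed
qed

section \<open>Continuity of both maps\<close>

text \<open>By \<open>ult_dir_eq_iff\<close>, prescribing the value \<open>\<rho> F\<close> at
  \<open>F\<close> means that \<open>u\<close> contains the class of \<open>\<rho> F\<close>, which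
  is a basic open condition.\<close>

lemma continuous_map_ult_dir:
  assumes "connected_graph V E"
  shows "continuous_map (ult_space (cut_algebra V E)) (edge_direction_space V E) ult_dir"
  unfolding edge_direction_space_def
proof (rule continuous_on_generated_topo)
  show "ult_dir ` topspace (ult_space (cut_algebra V E)) \<subseteq> \<Union>(edge_direction_basics V E)"
    unfolding topspace_ult_space
      topspace_edge_direction_space[unfolded edge_direction_space_def topology_generated_by_topspace]
    using ult_dir_in_edge_directions[OF assms] by blast
  fix U assume "U \<in> edge_direction_basics V E"
  then obtain \<rho> F where \<rho>: "\<rho> \<in> edge_directions V E" and F: "F \<in> fin_edge_sets E"
    and U: "U = {\<rho>' \<in> edge_directions V E. \<rho>' F = \<rho> F}"
    by (auto simp: edge_direction_basics_def)
  note comp = dir_component(1)[OF \<rho> F]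
  have "ult_dir -` U \<inter> topspace (ult_space (cut_algebra V E))
      = ult_basic (cut_algebra V E) (cut_class V E (\<rho> F))"
    unfolding U topspace_ult_space ult_basic_def
    using ult_dir_in_edge_directions[OF assms] ult_dir_eq_iff[OF assms _ F comp] by blast
  moreover have "\<rho> F \<in> cuts V E"
    using component_cuts[OF comp] F by (simp add: fin_edge_sets_def)
  ultimately show "openin (ult_space (cut_algebra V E))
      (ult_dir -` U \<inter> topspace (ult_space (cut_algebra V E)))"
    by (simp add: ult_space_def elems_cut_algebra topology_generated_by_Basis)
qed

text \<open>Whether \<open>dir_ult \<rho>\<close> contains the class of \<open>A\<close> depends
  only on the value of \<rho> at \<delta> A, so the preimage is a union of basic open sets.\<close>

lemma continuous_map_dir_ult:
  "continuous_map (edge_direction_space V E) (ult_space (cut_algebra V E)) dir_ult"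
  unfolding ult_space_def
proof (rule continuous_on_generated_topo)
  show "dir_ult ` topspace (edge_direction_space V E)
      \<subseteq> \<Union>(ult_basic (cut_algebra V E) ` elems (cut_algebra V E))"
    unfolding topspace_edge_direction_space
      topspace_ult_space[unfolded ult_space_def topology_generated_by_topspace]
    using dir_ult_in_Ult by blast
  fix U assume "U \<in> ult_basic (cut_algebra V E) ` elems (cut_algebra V E)"
  then obtain A where A: "A \<in> cuts V E" and U: "U = ult_basic (cut_algebra V E) (cut_class V E A)"
    by (auto simp: elems_cut_algebra)
  let ?F = "cut_edges V E A"
  have "dir_ult -` U \<inter> topspace (edge_direction_space V E)
      = {\<rho> \<in> edge_directions V E. \<rho> ?F \<subseteq> A}"
    unfolding U ult_basic_def topspace_edge_direction_space
    using dir_ult_in_Ult cut_class_dir_ult_iff[OF _ A] by blast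
  also have "\<dots> = (\<Union>\<rho>\<in>{\<rho> \<in> edge_directions V E. \<rho> ?F \<subseteq> A}. {\<rho>' \<in> edge_directions V E. \<rho>' ?F = \<rho> ?F})"
    by auto
  also have "openin (edge_direction_space V E) \<dots>"
  proof (rule openin_Union, clarify)
    fix \<rho> assume "\<rho> \<in> edge_directions V E"
    then show "openin (edge_direction_space V E) {\<rho>' \<in> edge_directions V E. \<rho>' ?F = \<rho> ?F}"
      unfolding edge_direction_space_def edge_direction_basics_def
      using cut_edges_fin[OF A] by (intro topology_generated_by_Basis) blast
  qed
  finally show "openin (edge_direction_space V E)
      (dir_ult -` U \<inter> topspace (edge_direction_space V E))" .
qed

end

theorem theorem13:
  fixes V :: "'a set" and E :: "'a set set"
  assumes "simple_graph V E" and "connected_graph V E"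
  shows "ult_space (cut_algebra V E) homeomorphic_space edge_direction_space V E"
  unfolding homeomorphic_space_def homeomorphic_maps_def
proof (intro exI conjI ballI)
  show "continuous_map (ult_space (cut_algebra V E)) (edge_direction_space V E) (ult_dir V E)"
    by (rule continuous_map_ult_dir[OF assms])
  show "continuous_map (edge_direction_space V E) (ult_space (cut_algebra V E)) (dir_ult V E)"
    by (rule continuous_map_dir_ult[OF assms(1)])
qed (simp_all add: topspace_ult_space topspace_edge_direction_space
    dir_ult_ult_dir[OF assms] ult_dir_dir_ult[OF assms])

end
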